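(* Let $p\in\{0,1\}$ and let scalar complex-valued functions $v,\rho$ on $D$ be such that $v_t$ is continuous in $D$, $\overline{\rho(x,t)}=-\rho(-x,t)$, and in $D$ $$\rho_x(x,t)=\frac{(-1)^p}2\big(v(x,t)\overline{v_t(-x,t)}+v_t(x,t)\overline{v(-x,t)}\big),\qquad v_{tx}(x,t)=\rho(x,t)v(x,t).$$ Let $n\in\mathbb N$, let $A$ and $S(0,0)=-S(0,0)^*$ be invertible complex $n\times n$ matrices and $\Pi(0,0)$ a complex $n\times2$ matrix such that $$AS(0,0)+S(0,0)A^*=\mathrm i\,\Pi(0,0)j^p\Pi(0,0)^*,$$ and let $\Pi(x,t)$, $S(x,t)$ be determined by these initial values and the linear systems of the context. Then, at the points of $D$ where $S(x,t)$ is invertible, the functions $$\widetilde v(x,t)=v(x,t)+\mathrm i\,\Phi_1(-x,t)^*S(x,t)^{-1}\Phi_2(x,t),\qquad\widetilde\rho=\mathrm i\begin{bmatrix}0&1\end{bmatrix}\widetilde Q_{-1}\begin{bmatrix}0\\1\end{bmatrix}$$ satisfy $$\widetilde\rho_x(x,t)=\frac{(-1)^p}2\big(\widetilde v(x,t)\overline{\widetilde v_t(-x,t)}+\widetilde v_t(x,t)\overline{\widetilde v(-x,t)}\big),\qquad\widetilde v_{tx}(x,t)=\widetilde\rho(x,t)\widetilde v(x,t),$$ and $\overline{\widetilde\rho(x,t)}=-\widetilde\rho(-x,t)$.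
   Context: Notation. $j=\begin{bmatrix}1&0\\0&-1\end{bmatrix}$; subscripts $x,t$ denote partial derivatives ($v_t(-x,t)$ is $\partial v/\partial t$ evaluated at $(-x,t)$); $\overline{\,\cdot\,}$ is complex conjugation and $^*$ the conjugate transpose. The domain is $D=\{(x,t):\ -a<x<a,\ b_1<t<b_2\}$ with $0<a\le\infty$, $-\infty\le b_1<0<b_2\le\infty$. Set $$V(x,t)=\begin{bmatrix}0&v(x,t)\\ \overline{v(-x,t)}&0\end{bmatrix},\quad q_1=-\tfrac{\mathrm i}4j,\quad q_0=\tfrac{\mathrm i}2j^{p+1}V,\quad Q_{-1}=\mathrm i\rho j-j^pV_t.$$ Linear systems: $\Pi_x=\Pi q_0+A\Pi q_1$, $\Pi_t=A^{-1}\Pi Q_{-1}$, $$S_x(x,t)=\mathrm i\,\Pi(x,t)q_1j^p\Pi(-x,t)^*,\qquad S_t(x,t)=\mathrm i A^{-1}\Pi(x,t)Q_{-1}(x,t)j^p\Pi(-x,t)^*(A^* )^{-1}.$$ $\Pi=[\Phi_1\ \ \Phi_2]$ is the partition into two $n\times1$ columns. At points where $S$ is invertible, $$X_{-1}(x,t)=\mathrm i j^p\Pi(-x,t)^*S(x,t)^{-1}A^{-1}\Pi(x,t),\quad Y_{-1}(x,t)=-\mathrm i j^p\Pi(-x,t)^*(A^{-1})^*S(x,t)^{-1}\Pi(x,t),$$ $$\widetilde Q_{-1}=(I_2-X_{-1})Q_{-1}(I_2+Y_{-1}).$$ *)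

theory Defs
  imports "HOL-Analysis.Analysis"
begin

(* The type instances * and ^ on vectors are componentwise, so powers and complex multiples
   of matrices are introduced explicitly; the matrix product is the library's **. *)

definition cmul :: "complex \<Rightarrow> complex^'m^'n \<Rightarrow> complex^'m^'n"  (infixr \<open>*\<^sub>C\<close> 75) where
  "c *\<^sub>C M = map_matrix (\<lambda>z. c * z) M"

definition mat_pow :: "complex^'n^'n \<Rightarrow> nat \<Rightarrow> complex^'n^'n" where
  "mat_pow M k = (((**) M) ^^ k) (mat 1)"

definition ctranspose :: "complex^'m^'n \<Rightarrow> complex^'n^'m" where
  "ctranspose M = map_matrix cnj (transpose M)"

(* partial_t has a junk value where the derivative does not exist; existence has to be stated
   separately. *)

definition partial_t :: "(real \<Rightarrow> real \<Rightarrow> 'b::real_normed_vector) \<Rightarrow> real \<Rightarrow> real \<Rightarrow> 'b" where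
  "partial_t f x t = vector_derivative (\<lambda>s. f x s) (at t)"

definition has_partial_x ::
    "(real \<Rightarrow> real \<Rightarrow> 'b::real_normed_vector) \<Rightarrow> 'b \<Rightarrow> real \<Rightarrow> real \<Rightarrow> bool" where
  "has_partial_x f d x t \<longleftrightarrow> ((\<lambda>y. f y t) has_vector_derivative d) (at x)"

definition has_partial_t ::
    "(real \<Rightarrow> real \<Rightarrow> 'b::real_normed_vector) \<Rightarrow> 'b \<Rightarrow> real \<Rightarrow> real \<Rightarrow> bool" where
  "has_partial_t f d x t \<longleftrightarrow> ((\<lambda>s. f x s) has_vector_derivative d) (at t)"

definition strip :: "ereal \<Rightarrow> ereal \<Rightarrow> ereal \<Rightarrow> (real \<times> real) set" where
  "strip a b1 b2 = {(x, t). - a < ereal x \<and> ereal x < a \<and> b1 < ereal t \<and> ereal t < b2}"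

definition jmat :: "complex^2^2" where
  "jmat = vector [vector [1, 0], vector [0, -1]]"

definition Vmat :: "(real \<Rightarrow> real \<Rightarrow> complex) \<Rightarrow> real \<Rightarrow> real \<Rightarrow> complex^2^2" where
  "Vmat v x t = vector [vector [0, v x t], vector [cnj (v (- x) t), 0]]"

definition q1 :: "complex^2^2" where
  "q1 = (- \<i> / 4) *\<^sub>C jmat"

definition q0 :: "nat \<Rightarrow> (real \<Rightarrow> real \<Rightarrow> complex) \<Rightarrow> real \<Rightarrow> real \<Rightarrow> complex^2^2" where
  "q0 p v x t = (\<i> / 2) *\<^sub>C (mat_pow jmat (p + 1) ** Vmat v x t)"

definition Qm1 :: "nat \<Rightarrow> (real \<Rightarrow> real \<Rightarrow> complex) \<Rightarrow> (real \<Rightarrow> real \<Rightarrow> complex)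
    \<Rightarrow> real \<Rightarrow> real \<Rightarrow> complex^2^2" where
  "Qm1 p v \<rho> x t =
     (\<i> * \<rho> x t) *\<^sub>C jmat - mat_pow jmat p ** partial_t (Vmat v) x t"

definition Xm1 :: "nat \<Rightarrow> complex^'n^'n \<Rightarrow> (real \<Rightarrow> real \<Rightarrow> complex^'n^'n)
    \<Rightarrow> (real \<Rightarrow> real \<Rightarrow> complex^2^'n) \<Rightarrow> real \<Rightarrow> real \<Rightarrow> complex^2^2" where
  "Xm1 p A S P x t =
     \<i> *\<^sub>C (mat_pow jmat p ** ctranspose (P (- x) t) ** matrix_inv (S x t)
          ** matrix_inv A ** P x t)"

definition Ym1 :: "nat \<Rightarrow> complex^'n^'n \<Rightarrow> (real \<Rightarrow> real \<Rightarrow> complex^'n^'n)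
    \<Rightarrow> (real \<Rightarrow> real \<Rightarrow> complex^2^'n) \<Rightarrow> real \<Rightarrow> real \<Rightarrow> complex^2^2" where
  "Ym1 p A S P x t =
     (- \<i>) *\<^sub>C (mat_pow jmat p ** ctranspose (P (- x) t) ** ctranspose (matrix_inv A)
          ** matrix_inv (S x t) ** P x t)"

definition Qm1_tilde :: "nat \<Rightarrow> (real \<Rightarrow> real \<Rightarrow> complex) \<Rightarrow> (real \<Rightarrow> real \<Rightarrow> complex)
    \<Rightarrow> complex^'n^'n \<Rightarrow> (real \<Rightarrow> real \<Rightarrow> complex^'n^'n)
    \<Rightarrow> (real \<Rightarrow> real \<Rightarrow> complex^2^'n) \<Rightarrow> real \<Rightarrow> real \<Rightarrow> complex^2^2" where
  "Qm1_tilde p v \<rho> A S P x t =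
     (mat 1 - Xm1 p A S P x t) ** Qm1 p v \<rho> x t ** (mat 1 + Ym1 p A S P x t)"

(* In v_tilde and rho_tilde, $1$1 reads off the entry of a 1-by-1 matrix. *)

definition v_tilde :: "(real \<Rightarrow> real \<Rightarrow> complex) \<Rightarrow> (real \<Rightarrow> real \<Rightarrow> complex^'n^'n)
    \<Rightarrow> (real \<Rightarrow> real \<Rightarrow> complex^2^'n) \<Rightarrow> real \<Rightarrow> real \<Rightarrow> complex" where
  "v_tilde v S P x t =
     v x t + \<i> * (ctranspose (columnvector (column 1 (P (- x) t)) :: complex^1^'n)
                 ** matrix_inv (S x t)
                 ** (columnvector (column 2 (P x t)) :: complex^1^'n)) $ 1 $ 1"

definition rho_tilde :: "nat \<Rightarrow> (real \<Rightarrow> real \<Rightarrow> complex) \<Rightarrow> (real \<Rightarrow> real \<Rightarrow> complex)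
    \<Rightarrow> complex^'n^'n \<Rightarrow> (real \<Rightarrow> real \<Rightarrow> complex^'n^'n)
    \<Rightarrow> (real \<Rightarrow> real \<Rightarrow> complex^2^'n) \<Rightarrow> real \<Rightarrow> real \<Rightarrow> complex" where
  "rho_tilde p v \<rho> A S P x t =
     \<i> * ((rowvector (vector [0, 1]) :: complex^2^1) ** Qm1_tilde p v \<rho> A S P x t
          ** (columnvector (vector [0, 1]) :: complex^1^2)) $ 1 $ 1"

end

theory Submission
  imports Defs
begin

text \<open>
  The nonlocal equations are the solvability condition of a linear pair with a spectral parameter
  \<open>\<lambda>\<close>, \<open>u\<^sub>x = u (q\<^sub>0 + \<lambda> q\<^sub>1)\<close> and \<open>u\<^sub>t = \<lambda>\<inverse> u Q\<close>: the coefficient of \<open>\<lambda>\<inverse>\<close> gives the Lax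
  equation \<open>Q\<^sub>x = Q q\<^sub>0 - q\<^sub>0 Q\<close>, whose diagonal entries are the equation for \<open>\<rho>\<^sub>x\<close> and whose
  off-diagonal entries are the equation for \<open>v\<^sub>t\<^sub>x\<close> at \<open>(x, t)\<close> and, conjugated, at \<open>(- x, t)\<close>.
  The matrix function \<open>P\<close> solves the same pair with the scalar \<open>\<lambda>\<close> replaced by the matrix \<open>A\<close>.
  So it suffices to find a gauge transformation that carries the Lax equation to one of the same
  form, with coefficients built in the same way from the new functions.

  Nonlocality enters only through the reflection \<open>M \<mapsto> J M(- x, t)\<^sup>*\<close>, where \<open>J\<close> is the \<open>p\<close>-th power
  of \<open>j\<close>. The coefficients satisfy \<open>J q\<^sub>0(- x, t)\<^sup>* = q\<^sub>0 J\<close>, \<open>J q\<^sub>1\<^sup>* = - q\<^sub>1 J\<close> and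
  \<open>J Q(- x, t)\<^sup>* = Q J\<close>, so \<open>L = J P(- x, t)\<^sup>*\<close> solves the adjoint pair at the same point
  (\<open>L_x\<close>, \<open>L_t\<close>), and from there on everything is the usual local binary Darboux calculus for
  \<open>P\<close>, \<open>L\<close> and \<open>S\<close>. The differential equations for \<open>S\<close> are such that the Sylvester identity
  \<open>A S + S A\<^sup>* = \<i> P L\<close> and the symmetry \<open>S(- x, t) = - S(x, t)\<^sup>*\<close> are preserved
  (\<open>sylvester\<close>, \<open>S_reflect\<close>); both hold at the origin and hence throughout the rectangle.

  Let \<open>W = I - X\<close>. The Sylvester identity gives \<open>W\<inverse> = I + Y\<close> (\<open>darboux_inverse\<close>), so the new
  coefficient is the conjugate \<open>W Q W\<inverse>\<close>, and it gives
  \<open>W\<^sub>x = W q\<^sub>0 - q\<^sub>0\<^sup>~ W\<close> with \<open>q\<^sub>0\<^sup>~ = q\<^sub>0 + \<i> (Z q\<^sub>1 - q\<^sub>1 Z)\<close> and \<open>Z = L S\<inverse> P\<close> (\<open>darboux_x\<close>).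
  Conjugation by such a \<open>W\<close> preserves Lax equations (\<open>lax_conjugation\<close>). It remains to recognise
  the entries. The new potential is \<open>v\<close> plus \<open>\<i>\<close> times the upper right entry of \<open>Z\<close>, and \<open>q\<^sub>0\<^sup>~\<close>
  is \<open>q\<^sub>0\<close> formed with it (\<open>q0t_eq\<close>). Since \<open>Z\<^sub>t = \<i> (W Q W\<inverse> - Q)\<close> (\<open>darboux_t\<close>), its time
  derivative is minus the upper right entry of \<open>W Q W\<inverse>\<close>; trace zero and the reflection symmetry,
  both inherited from \<open>Q\<close>, determine the other entries (\<open>Qt_nth\<close>). Reading the transformed Lax
  equation entrywise gives the claim.
\<close>

section \<open>Calculus of complex matrices\<close>

lemma bounded_bilinear_matrix_mult:
  "bounded_bilinear ((**) :: complex^'m^'n \<Rightarrow> complex^'k^'m \<Rightarrow> complex^'k^'n)"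
  unfolding bilinear_conv_bounded_bilinear[symmetric] bilinear_def linear_iff
  by (auto simp: matrix_matrix_mult_def vec_eq_iff algebra_simps sum.distrib scaleR_right.sum)

lemmas matrix_distrib =
  bounded_bilinear.add_left[OF bounded_bilinear_matrix_mult]
  bounded_bilinear.add_right[OF bounded_bilinear_matrix_mult]
  bounded_bilinear.diff_left[OF bounded_bilinear_matrix_mult]
  bounded_bilinear.diff_right[OF bounded_bilinear_matrix_mult]
  bounded_bilinear.minus_left[OF bounded_bilinear_matrix_mult]
  bounded_bilinear.minus_right[OF bounded_bilinear_matrix_mult]
  bounded_bilinear.zero_left[OF bounded_bilinear_matrix_mult]
  bounded_bilinear.zero_right[OF bounded_bilinear_matrix_mult]

lemma cmul_nth [simp]: "(c *\<^sub>C M) $ i $ k = c * M $ i $ k"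
  by (simp add: cmul_def)

lemma cmul_matrix_mult:
  "(c *\<^sub>C M) ** N = c *\<^sub>C (M ** N)" "M ** (c *\<^sub>C N) = c *\<^sub>C (M ** N)"
  by (simp_all add: vec_eq_iff matrix_matrix_mult_def sum_distrib_left mult_ac)

lemma cmul_distrib:
  "c *\<^sub>C (M + N) = c *\<^sub>C M + c *\<^sub>C N" "c *\<^sub>C (M - N) = c *\<^sub>C M - c *\<^sub>C N"
  "c *\<^sub>C (- M) = - (c *\<^sub>C M)" "(- c) *\<^sub>C M = - (c *\<^sub>C M)"
  "c *\<^sub>C 0 = 0" "c *\<^sub>C (d *\<^sub>C M) = (c * d) *\<^sub>C M" "1 *\<^sub>C M = M"
  by (simp_all add: vec_eq_iff algebra_simps)

text \<open>Rewriting with these rules brings an expression to a sum of scalar multiples of right-associated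
products, after which a noncommutative polynomial identity holds by linear rearrangement.\<close>

lemmas matrix_normalize =
  matrix_distrib cmul_matrix_mult cmul_distrib matrix_mul_assoc[symmetric]

lemma ctranspose_nth [simp]: "ctranspose M $ i $ k = cnj (M $ k $ i)"
  by (simp add: ctranspose_def transpose_def)

lemma ctranspose_mult: "ctranspose (M ** N) = ctranspose N ** ctranspose M"
  by (simp add: vec_eq_iff matrix_matrix_mult_def mult.commute)

lemma ctranspose_cmul: "ctranspose (c *\<^sub>C M) = cnj c *\<^sub>C ctranspose M"
  by (simp add: vec_eq_iff)

lemma ctranspose_arith:
  "ctranspose (M + N) = ctranspose M + ctranspose N"
  "ctranspose (M - N) = ctranspose M - ctranspose N"
  "ctranspose (- M) = - ctranspose M"
  "ctranspose (ctranspose M) = M"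
  "ctranspose (mat 1) = mat 1"
  by (simp_all add: vec_eq_iff mat_def)

lemma bounded_linear_ctranspose:
  "bounded_linear (ctranspose :: complex^'m^'n \<Rightarrow> complex^'n^'m)"
  by (simp add: linear_conv_bounded_linear[symmetric] linear_iff vec_eq_iff)

lemma bounded_linear_cmul: "bounded_linear ((*\<^sub>C) c :: complex^'m^'n \<Rightarrow> complex^'m^'n)"
  by (simp add: linear_conv_bounded_linear[symmetric] linear_iff vec_eq_iff algebra_simps)

lemma bounded_linear_entry: "bounded_linear (\<lambda>M :: complex^'m^'n. M $ i $ k)"
  by (simp add: linear_conv_bounded_linear[symmetric] linear_iff)

lemma has_vector_derivative_matrix_mult:
  fixes F :: "real \<Rightarrow> complex^'m^'n" and G :: "real \<Rightarrow> complex^'k^'m"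
  assumes "(F has_vector_derivative F') (at x within U)"
    and "(G has_vector_derivative G') (at x within U)"
  shows "((\<lambda>x. F x ** G x) has_vector_derivative (F x ** G' + F' ** G x)) (at x within U)"
  by (rule bounded_bilinear.has_vector_derivative[OF bounded_bilinear_matrix_mult assms])

lemmas has_vector_derivative_ctranspose =
  bounded_linear.has_vector_derivative[OF bounded_linear_ctranspose]

lemmas has_vector_derivative_cmul =
  bounded_linear.has_vector_derivative[OF bounded_linear_cmul]

lemmas has_vector_derivative_entry =
  bounded_linear.has_vector_derivative[OF bounded_linear_entry]

lemma has_vector_derivative_matrixI:
  fixes F :: "real \<Rightarrow> complex^'m^'n"
  assumes "\<And>i k. ((\<lambda>x. F x $ i $ k) has_vector_derivative F' $ i $ k) (at x)"
  shows "(F has_vector_derivative F') (at x)"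
  using assms
  by (auto simp: has_vector_derivative_def has_derivative_def bounded_linear_scaleR_left
      intro!: vec_tendstoI)

lemma has_vector_derivative_reflect:
  assumes "(f has_vector_derivative f') (at (- x))"
  shows "((\<lambda>y. f (- y)) has_vector_derivative - f') (at (x :: real))"
proof -
  have "((f \<circ> uminus) has_vector_derivative (- 1) *\<^sub>R f') (at x)"
    by (rule vector_diff_chain_at) (use assms in \<open>auto intro!: derivative_eq_intros\<close>)
  then show ?thesis
    by (simp add: o_def)
qed

lemma matrix_inv_mult:
  fixes M :: "complex^'n^'n"
  assumes "invertible M"
  shows "M ** matrix_inv M = mat 1" "matrix_inv M ** M = mat 1"
  using assms unfolding invertible_def matrix_inv_def
  by (metis (mono_tags, lifting) someI_ex)+

lemma matrix_inv_eqI: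
  fixes M N :: "complex^'n^'n"
  assumes "N ** M = mat 1"
  shows "matrix_inv M = N" "invertible M"
proof -
  show inv: "invertible M"
    using assms invertible_left_inverse by blast
  have "matrix_inv M = N ** M ** matrix_inv M"
    by (simp add: assms)
  then show "matrix_inv M = N"
    by (simp add: matrix_mul_assoc[symmetric] matrix_inv_mult[OF inv])
qed

lemma tendsto_det:
  fixes F :: "'a::topological_space \<Rightarrow> complex^'n^'n"
  assumes "(F \<longlongrightarrow> M) net"
  shows "((\<lambda>x. det (F x)) \<longlongrightarrow> det M) net"
  unfolding det_def by (intro tendsto_intros assms)

text \<open>Cramer's rule for the columns of the inverse. It shows that the entries of the inverse are continuous in the
entries of the matrix.\<close>

lemma matrix_inv_nth:
  fixes M :: "complex^'n^'n"
  assumes "invertible M"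
  shows "matrix_inv M $ k $ l =
    det (\<chi> i j. if j = k then mat 1 $ i $ l else M $ i $ j) / det M"
proof -
  have "M *v (matrix_inv M *v axis l 1) = axis l 1"
    by (simp add: matrix_vector_mul_assoc matrix_inv_mult[OF assms])
  then have entry: "(M *v (matrix_inv M *v axis l 1)) $ i = (mat 1 :: complex^'n^'n) $ i $ l" for i
    by (simp add: axis_def mat_def)
  have "det (\<chi> i j. if j = k then mat 1 $ i $ l else M $ i $ j)
      = (matrix_inv M *v axis l 1) $ k * det M"
    using cramer_lemma[where A = M and x = "matrix_inv M *v axis l 1" and k = k]
    by (simp only: entry)
  moreover have "(matrix_inv M *v axis l 1) $ k = matrix_inv M $ k $ l"
    by (simp add: matrix_vector_mult_def axis_def if_distrib cong: if_cong)
  ultimately show ?thesis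
    using assms by (simp add: invertible_det_nz)
qed

lemma tendsto_matrix_inv:
  fixes F :: "real \<Rightarrow> complex^'n^'n"
  assumes cont: "isCont F x" and inv: "invertible (F x)"
  shows "\<forall>\<^sub>F y in at x. invertible (F y)"
    and "((\<lambda>y. matrix_inv (F y)) \<longlongrightarrow> matrix_inv (F x)) (at x)"
proof -
  have F: "(F \<longlongrightarrow> F x) (at x)"
    using cont by (simp add: isCont_def)
  have nz: "det (F x) \<noteq> 0"
    using inv by (simp add: invertible_det_nz)
  show ev: "\<forall>\<^sub>F y in at x. invertible (F y)"
    using tendsto_imp_eventually_ne[OF tendsto_det[OF F] nz] by (simp add: invertible_det_nz)
  show "((\<lambda>y. matrix_inv (F y)) \<longlongrightarrow> matrix_inv (F x)) (at x)"
  proof (intro vec_tendstoI)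
    fix k l
    let ?R = "\<lambda>M :: complex^'n^'n. (\<chi> i j. if j = k then mat 1 $ i $ l else M $ i $ j)"
    have "((\<lambda>y. ?R (F y)) \<longlongrightarrow> ?R (F x)) (at x)"
      using F by (intro tendsto_vec_lambda) (simp add: tendsto_vec_nth)
    then have "((\<lambda>y. det (?R (F y)) / det (F y)) \<longlongrightarrow> det (?R (F x)) / det (F x)) (at x)"
      by (intro tendsto_divide tendsto_det F nz)
    then have "((\<lambda>y. det (?R (F y)) / det (F y)) \<longlongrightarrow> matrix_inv (F x) $ k $ l) (at x)"
      by (simp only: matrix_inv_nth[OF inv])
    moreover have "\<forall>\<^sub>F y in at x. det (?R (F y)) / det (F y) = matrix_inv (F y) $ k $ l"
      using ev by eventually_elim (simp only: matrix_inv_nth)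
    ultimately show "((\<lambda>y. matrix_inv (F y) $ k $ l) \<longlongrightarrow> matrix_inv (F x) $ k $ l) (at x)"
      by (rule Lim_transform_eventually)
  qed
qed

lemma has_vector_derivative_iff_quotient:
  fixes f :: "real \<Rightarrow> 'a::real_normed_vector"
  shows "(f has_vector_derivative f') (at x) \<longleftrightarrow>
    ((\<lambda>y. (f y - f x) /\<^sub>R (y - x)) \<longlongrightarrow> f') (at x)"
proof -
  have "(f y - f x) /\<^sub>R (y - x) - f' = (f y - f x - (y - x) *\<^sub>R f') /\<^sub>R (y - x)"
    if "y \<noteq> x" for y
    using that by (simp add: scaleR_diff_right)
  then have *: "norm ((f y - f x - (y - x) *\<^sub>R f') /\<^sub>R norm (y - x))
     = norm ((f y - f x) /\<^sub>R (y - x) - f')" if "y \<noteq> x" for y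
    using that by simp
  have "((\<lambda>y. (f y - f x - (y - x) *\<^sub>R f') /\<^sub>R norm (y - x)) \<longlongrightarrow> 0) (at x) \<longleftrightarrow>
     ((\<lambda>y. (f y - f x) /\<^sub>R (y - x) - f') \<longlongrightarrow> 0) (at x)"
    unfolding tendsto_norm_zero_iff[symmetric, where 'b = 'a]
    by (rule tendsto_cong) (use * in \<open>auto simp: eventually_at_filter\<close>)
  then show ?thesis
    by (simp add: has_vector_derivative_def has_derivative_at_within bounded_linear_scaleR_left
        LIM_zero_iff)
qed

text \<open>Continuity of the inverse suffices for its differentiability, because
\<open>F(y)\<inverse> - F(x)\<inverse> = - F(y)\<inverse> (F(y) - F(x)) F(x)\<inverse>\<close>.\<close>

lemma has_vector_derivative_matrix_inv:
  fixes F :: "real \<Rightarrow> complex^'n^'n"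
  assumes F: "(F has_vector_derivative F') (at x)" and inv: "invertible (F x)"
  shows "((\<lambda>y. matrix_inv (F y)) has_vector_derivative
           - (matrix_inv (F x) ** F' ** matrix_inv (F x))) (at x)"
proof -
  let ?T = "\<lambda>y. matrix_inv (F y)"
  have "isCont F x"
    using F has_vector_derivative_continuous by blast
  note T = tendsto_matrix_inv[OF this inv]
  have "((\<lambda>y. ?T y ** ((F y - F x) /\<^sub>R (y - x)) ** ?T x) \<longlongrightarrow> ?T x ** F' ** ?T x) (at x)"
    using F unfolding has_vector_derivative_iff_quotient
    by (intro bounded_bilinear.tendsto[OF bounded_bilinear_matrix_mult] T tendsto_const)
  then have "((\<lambda>y. - (?T y ** ((F y - F x) /\<^sub>R (y - x)) ** ?T x)) \<longlongrightarrow> - (?T x ** F' ** ?T x)) (at x)"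
    by (rule tendsto_minus)
  moreover have "\<forall>\<^sub>F y in at x. - (?T y ** ((F y - F x) /\<^sub>R (y - x)) ** ?T x) = (?T y - ?T x) /\<^sub>R (y - x)"
    using T(1)
  proof eventually_elim
    case (elim y)
    \<comment> \<open>The resolvent identity, which turns the difference quotient of the inverse into that of \<open>F\<close>.\<close>
    have "?T y ** (F y - F x) ** ?T x = (?T y ** F y) ** ?T x - ?T y ** (F x ** ?T x)"
      by (simp only: matrix_normalize)
    also have "\<dots> = ?T x - ?T y"
      by (simp add: matrix_inv_mult elim inv)
    finally show ?case
      by (simp add: bounded_bilinear.scaleR_left[OF bounded_bilinear_matrix_mult]
          bounded_bilinear.scaleR_right[OF bounded_bilinear_matrix_mult] scaleR_minus_right[symmetric])
  qed
  ultimately show ?thesis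
    unfolding has_vector_derivative_iff_quotient by (rule Lim_transform_eventually)
qed

section \<open>Binary Darboux transformation of a linear pair\<close>

text \<open>The matrix function \<open>R\<close> solves the \<open>t\<close>-equation and \<open>L\<close> its adjoint, with the spectral parameter
replaced by matrices. The product rule produces \<open>Q Y\<close>, \<open>X Q\<close> and \<open>X Q Y\<close>, which are exactly the terms of
\<open>(I - X) Q (I + Y) - Q\<close>.\<close>

lemma darboux_t:
  fixes L :: "real \<Rightarrow> complex^'n^2" and R :: "real \<Rightarrow> complex^2^'n"
    and S :: "real \<Rightarrow> complex^'n^'n"
  assumes L: "(L has_vector_derivative (Q ** L t ** E)) (at t)"
    and R: "(R has_vector_derivative (B ** R t ** Q)) (at t)"
    and S: "(S has_vector_derivative (\<i> *\<^sub>C (B ** R t ** Q ** L t ** E))) (at t)"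
    and inv: "invertible (S t)"
  shows "((\<lambda>s. L s ** matrix_inv (S s) ** R s) has_vector_derivative
     \<i> *\<^sub>C ((mat 1 - \<i> *\<^sub>C (L t ** matrix_inv (S t) ** B ** R t)) ** Q
        ** (mat 1 + (- \<i>) *\<^sub>C (L t ** E ** matrix_inv (S t) ** R t)) - Q)) (at t)"
  apply (rule has_vector_derivative_eq_rhs)
   apply (rule has_vector_derivative_matrix_mult L R S has_vector_derivative_matrix_inv inv)+
  apply (simp add: matrix_normalize algebra_simps)
  done

text \<open>The Sylvester identity multiplied on both sides by inverses. The first form is the one that \<open>W\<^sub>x\<close>
needs, the second one is \<open>(I - X) (I + Y) = I\<close> before multiplication by \<open>L\<close> and \<open>R\<close>.\<close>

lemma sylvester_inverse:
  fixes A B C E S T :: "complex^'n^'n" and L :: "complex^'n^2" and R :: "complex^2^'n"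
  assumes syl: "A ** S + S ** C = \<i> *\<^sub>C (R ** L)"
    and BA: "B ** A = mat 1" and CE: "C ** E = mat 1"
    and ST: "S ** T = mat 1" and TS: "T ** S = mat 1"
  shows "T ** A + C ** T = \<i> *\<^sub>C (T ** R ** L ** T)"
    and "E ** T + T ** B = \<i> *\<^sub>C (T ** B ** R ** L ** E ** T)"
proof -
  have "T ** (A ** S + S ** C) ** T = T ** A ** (S ** T) + (T ** S) ** C ** T"
    by (simp only: matrix_normalize)
  then show "T ** A + C ** T = \<i> *\<^sub>C (T ** R ** L ** T)"
    by (simp add: ST TS syl cmul_matrix_mult matrix_mul_assoc)
  have "T ** B ** (A ** S + S ** C) ** E ** T
      = T ** (B ** A) ** S ** E ** T + T ** B ** S ** (C ** E) ** T"
    by (simp only: matrix_normalize)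
  also have "\<dots> = (T ** S) ** E ** T + T ** B ** (S ** T)"
    by (simp add: BA CE matrix_mul_assoc[symmetric])
  finally show "E ** T + T ** B = \<i> *\<^sub>C (T ** B ** R ** L ** E ** T)"
    by (simp add: ST TS syl cmul_matrix_mult matrix_mul_assoc)
qed

text \<open>With \<open>X = \<i> L T B R\<close> and \<open>Y = - \<i> L E T R\<close> the product \<open>X Y\<close> contains \<open>T B R L E T\<close>, which the
hypothesis splits into \<open>E T + T B\<close>; this gives \<open>X Y = Y - X\<close>.\<close>

lemma darboux_inverse:
  fixes B E S T :: "complex^'n^'n" and L :: "complex^'n^2" and R :: "complex^2^'n"
  assumes ETB: "E ** T + T ** B = \<i> *\<^sub>C (T ** B ** R ** L ** E ** T)"
  shows "(mat 1 - \<i> *\<^sub>C (L ** T ** B ** R)) ** (mat 1 + (- \<i>) *\<^sub>C (L ** E ** T ** R)) = mat 1"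
proof -
  have "L ** (E ** T + T ** B) ** R = L ** (\<i> *\<^sub>C (T ** B ** R ** L ** E ** T)) ** R"
    by (simp only: ETB)
  then have "(- \<i>) *\<^sub>C (\<i> *\<^sub>C (L ** T ** B ** R ** L ** E ** T ** R))
      = (- \<i>) *\<^sub>C (L ** E ** T ** R + L ** T ** B ** R)"
    by (simp add: matrix_normalize)
  then show ?thesis
    by (simp add: matrix_normalize)
qed

text \<open>Apart from \<open>q L C S\<inverse> B R\<close>, which comes from the derivative of \<open>L\<close>, all terms of \<open>W'\<close> are products
of \<open>q'\<close>, \<open>q\<close>, \<open>Z\<close> and \<open>W\<close>. The Sylvester identity replaces \<open>C S\<inverse>\<close> by \<open>\<i> S\<inverse> R L S\<inverse> - S\<inverse> A\<close>, and \<open>A\<close> then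
cancels against \<open>B\<close>, so that this term becomes such a product as well.\<close>

lemma darboux_x:
  fixes L :: "real \<Rightarrow> complex^'n^2" and R :: "real \<Rightarrow> complex^2^'n"
    and S :: "real \<Rightarrow> complex^'n^'n" and A B C :: "complex^'n^'n"
  assumes L: "(L has_vector_derivative (q ** L x ** C - q' ** L x)) (at x)"
    and R: "(R has_vector_derivative (R x ** q' + A ** R x ** q)) (at x)"
    and S: "(S has_vector_derivative (\<i> *\<^sub>C (R x ** q ** L x))) (at x)"
    and inv: "invertible (S x)" and BA: "B ** A = mat 1" and AB: "A ** B = mat 1"
    and syl: "matrix_inv (S x) ** A + C ** matrix_inv (S x)
        = \<i> *\<^sub>C (matrix_inv (S x) ** R x ** L x ** matrix_inv (S x))"
  defines "Z \<equiv> L x ** matrix_inv (S x) ** R x"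
    and "W \<equiv> \<lambda>y. mat 1 - \<i> *\<^sub>C (L y ** matrix_inv (S y) ** B ** R y)"
  shows "(W has_vector_derivative (W x ** q' - (q' + \<i> *\<^sub>C (Z ** q - q ** Z)) ** W x)) (at x)"
proof -
  let ?T = "matrix_inv (S x)"
  have CT: "C ** (?T ** M)
      = \<i> *\<^sub>C (?T ** (R x ** (L x ** (?T ** M)))) - ?T ** (A ** M)" for M :: "complex^2^'n"
    using arg_cong[OF syl, where f = "\<lambda>N. N ** M"]
    by (simp add: matrix_normalize algebra_simps)
  have BA': "A ** (B ** M) = M" "B ** (A ** M) = M" for M :: "complex^2^'n"
    by (simp_all add: matrix_mul_assoc AB BA)
  show ?thesis
    unfolding W_def Z_def
    apply (rule has_vector_derivative_eq_rhs)
     apply (rule has_vector_derivative_diff has_vector_derivative_const has_vector_derivative_cmul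
          has_vector_derivative_matrix_mult L R S has_vector_derivative_matrix_inv inv)+
    apply (simp add: matrix_normalize CT BA' algebra_simps)
    done
qed
text \<open>A gauge transformation maps a solution of one Lax equation to a solution of another: the terms with
\<open>q\<close> that come from \<open>W'\<close>, \<open>Q'\<close> and the derivative of the inverse cancel.\<close>

lemma lax_conjugation:
  fixes W Q :: "real \<Rightarrow> complex^'n^'n"
  assumes W: "(W has_vector_derivative (W x ** q - q' ** W x)) (at x)"
    and Q: "(Q has_vector_derivative (Q x ** q - q ** Q x)) (at x)"
    and inv: "invertible (W x)"
  defines "H \<equiv> \<lambda>y. W y ** Q y ** matrix_inv (W y)"
  shows "(H has_vector_derivative (H x ** q' - q' ** H x)) (at x)"
proof -
  note i = matrix_inv_mult[OF inv]
  have i': "matrix_inv (W x) ** (W x ** M) = M" "W x ** (matrix_inv (W x) ** M) = M" for M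
    using i by (simp_all add: matrix_mul_assoc)
  show ?thesis
    unfolding H_def
    apply (rule has_vector_derivative_eq_rhs)
     apply (rule has_vector_derivative_matrix_mult W Q has_vector_derivative_matrix_inv inv)+
    apply (simp add: matrix_normalize i i' algebra_simps)
    done
qed

section \<open>The coefficient matrices\<close>

lemma matrix_2_eqI:
  fixes M N :: "complex^2^2"
  assumes "M $ 1 $ 1 = N $ 1 $ 1" "M $ 1 $ 2 = N $ 1 $ 2" "M $ 2 $ 1 = N $ 2 $ 1" "M $ 2 $ 2 = N $ 2 $ 2"
  shows "M = N"
  using assms by (simp add: vec_eq_iff forall_2)

lemma matrix_mult_2_nth:
  fixes M N :: "complex^2^2"
  shows "(M ** N) $ i $ k = M $ i $ 1 * N $ 1 $ k + M $ i $ 2 * N $ 2 $ k"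
  by (simp add: matrix_matrix_mult_def sum_2)

lemma jmat_nth: "jmat $ 1 $ 1 = 1" "jmat $ 1 $ 2 = 0" "jmat $ 2 $ 1 = 0" "jmat $ 2 $ 2 = - 1"
  by (simp_all add: jmat_def)

lemma mat_pow_jmat_nth:
  "mat_pow jmat k $ 1 $ 1 = 1" "mat_pow jmat k $ 1 $ 2 = 0"
  "mat_pow jmat k $ 2 $ 1 = 0" "mat_pow jmat k $ 2 $ 2 = (- 1) ^ k"
proof -
  have "mat_pow jmat k $ 1 $ 1 = 1 \<and> mat_pow jmat k $ 1 $ 2 = 0
      \<and> mat_pow jmat k $ 2 $ 1 = 0 \<and> mat_pow jmat k $ 2 $ 2 = (- 1) ^ k"
    by (induction k) (simp_all add: mat_pow_def mat_def matrix_mult_2_nth jmat_nth)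
  then show "mat_pow jmat k $ 1 $ 1 = 1" "mat_pow jmat k $ 1 $ 2 = 0"
    "mat_pow jmat k $ 2 $ 1 = 0" "mat_pow jmat k $ 2 $ 2 = (- 1) ^ k"
    by simp_all
qed

lemma minus_one_power_square [simp]:
  "(- 1) ^ k * (- 1) ^ k = (1 :: complex)" "(- 1) ^ k * ((- 1) ^ k * z) = (z :: complex)"
  by (simp_all add: mult.assoc[symmetric] power_mult_distrib[symmetric])

lemma ctranspose_mat_pow_jmat: "ctranspose (mat_pow jmat k) = mat_pow jmat k"
  by (rule matrix_2_eqI) (simp_all add: mat_pow_jmat_nth)

lemma matrix_inv_ctranspose:
  fixes M :: "complex^'n^'n"
  assumes "invertible M"
  shows "matrix_inv (ctranspose M) = ctranspose (matrix_inv M)" "invertible (ctranspose M)"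
proof -
  have "ctranspose (matrix_inv M) ** ctranspose M = mat 1"
    by (simp add: ctranspose_mult[symmetric] matrix_inv_mult[OF assms] ctranspose_arith)
  then show "matrix_inv (ctranspose M) = ctranspose (matrix_inv M)" "invertible (ctranspose M)"
    by (rule matrix_inv_eqI)+
qed

lemma matrix_inv_uminus:
  fixes M :: "complex^'n^'n"
  assumes "invertible M"
  shows "matrix_inv (- M) = - matrix_inv M" "invertible (- M)"
proof -
  have "(- matrix_inv M) ** (- M) = mat 1"
    by (simp add: matrix_distrib matrix_inv_mult[OF assms])
  then show "matrix_inv (- M) = - matrix_inv M" "invertible (- M)"
    by (rule matrix_inv_eqI)+
qed

lemma q0_nth:
  "q0 p v x t $ 1 $ 1 = 0" "q0 p v x t $ 1 $ 2 = \<i> / 2 * v x t"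
  "q0 p v x t $ 2 $ 1 = - (\<i> / 2 * (- 1) ^ p * cnj (v (- x) t))" "q0 p v x t $ 2 $ 2 = 0"
  by (simp_all add: q0_def Vmat_def matrix_mult_2_nth mat_pow_jmat_nth)

lemma q1_nth: "q1 $ 1 $ 1 = - \<i> / 4" "q1 $ 1 $ 2 = 0" "q1 $ 2 $ 1 = 0" "q1 $ 2 $ 2 = \<i> / 4"
  by (simp_all add: q1_def jmat_nth)

section \<open>The domain\<close>

lemma strip_reflect: "(x, t) \<in> strip a b1 b2 \<Longrightarrow> (- x, t) \<in> strip a b1 b2"
  unfolding strip_def by (cases a) auto

lemma open_interval_ereal: "open {x :: real. c < ereal x \<and> ereal x < d}"
  using open_vimage[OF open_greaterThanLessThan[of c d], of ereal]
  by (simp add: vimage_def continuous_on_ereal)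

lemma convex_interval_ereal: "convex {x :: real. c < ereal x \<and> ereal x < d}"
  unfolding is_interval_convex_1[symmetric] is_interval_1
  by (cases c; cases d) auto

lemma open_strip_section: "open {y. (y, t) \<in> strip a b1 b2}"
  using open_interval_ereal[of "- a" a] by (cases "b1 < t \<and> t < b2") (auto simp: strip_def)

text \<open>One can move from the origin first along the \<open>t\<close>-axis
and then parallel to the \<open>x\<close>-axis, and the rectangle contains both segments.\<close>

lemma strip_constant:
  fixes F :: "real \<Rightarrow> real \<Rightarrow> 'a::real_normed_vector"
  assumes dx: "\<And>x t. (x, t) \<in> strip a b1 b2 \<Longrightarrow> ((\<lambda>y. F y t) has_vector_derivative 0) (at x)"
    and dt: "\<And>x t. (x, t) \<in> strip a b1 b2 \<Longrightarrow> ((\<lambda>s. F x s) has_vector_derivative 0) (at t)"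
    and 0: "0 < a" "b1 < 0" "0 < b2"
    and xt: "(x, t) \<in> strip a b1 b2"
  shows "F x t = F 0 0"
proof -
  have "- a < 0" 
    using 0(1) by (cases a) auto
  have "F x t = F 0 t"
  proof (rule has_derivative_zero_unique[where f = "\<lambda>x. F x t"])
    show "convex {x. - a < ereal x \<and> ereal x < a}"
      by (rule convex_interval_ereal)
    show "((\<lambda>x. F x t) has_derivative (\<lambda>h. 0)) (at y within {x. - a < ereal x \<and> ereal x < a})"
      if "y \<in> {x. - a < ereal x \<and> ereal x < a}" for y
      using dx[of y t] that xt
      by (auto simp: strip_def has_vector_derivative_def intro: has_derivative_at_withinI)
  qed (use xt 0 \<open>- a < 0\<close> in \<open>auto simp: strip_def zero_ereal_def\<close>)
  also have "F 0 t = F 0 0"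
  proof (rule has_derivative_zero_unique[where f = "\<lambda>s. F 0 s"])
    show "convex {s. b1 < ereal s \<and> ereal s < b2}"
      by (rule convex_interval_ereal)
    show "((\<lambda>s. F 0 s) has_derivative (\<lambda>h. 0)) (at s within {s. b1 < ereal s \<and> ereal s < b2})"
      if "s \<in> {s. b1 < ereal s \<and> ereal s < b2}" for s
      using dt[of 0 s] that 0 \<open>- a < 0\<close>
      by (auto simp: strip_def has_vector_derivative_def zero_ereal_def intro: has_derivative_at_withinI)
  qed (use xt 0 in \<open>auto simp: strip_def zero_ereal_def\<close>)
  finally show ?thesis .
qed

section \<open>The seed solution and its linear systems\<close>

text \<open>A seed solution \<open>v\<close>, \<open>\<rho>\<close> with the data \<open>A\<close>, \<open>P\<close>, \<open>S\<close> that generate a new one.\<close>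

locale gbdt =
  fixes p :: nat
    and a b1 b2 :: ereal
    and v \<rho> :: "real \<Rightarrow> real \<Rightarrow> complex"
    and A :: "complex^'n^'n"
    and S :: "real \<Rightarrow> real \<Rightarrow> complex^'n^'n"
    and P :: "real \<Rightarrow> real \<Rightarrow> complex^2^'n"
  assumes a: "0 < a" and b1: "b1 < 0" and b2: "0 < b2"
    and v_t: "\<And>x t. (x, t) \<in> strip a b1 b2 \<Longrightarrow> (\<lambda>s. v x s) differentiable (at t)"
    and \<rho>_reflect: "\<And>x t. (x, t) \<in> strip a b1 b2 \<Longrightarrow> cnj (\<rho> x t) = - \<rho> (- x) t"
    and \<rho>_x: "\<And>x t. (x, t) \<in> strip a b1 b2 \<Longrightarrow>
           has_partial_x \<rho>
             ((- 1) ^ p / 2 * (v x t * cnj (partial_t v (- x) t)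
                               + partial_t v x t * cnj (v (- x) t))) x t"
    and v_tx: "\<And>x t. (x, t) \<in> strip a b1 b2 \<Longrightarrow> has_partial_x (partial_t v) (\<rho> x t * v x t) x t"
    and inv_A: "invertible A"
    and S0_skew: "S 0 0 = - ctranspose (S 0 0)"
    and S0_sylvester: "A ** S 0 0 + S 0 0 ** ctranspose A
           = \<i> *\<^sub>C (P 0 0 ** mat_pow jmat p ** ctranspose (P 0 0))"
    and P_x: "\<And>x t. (x, t) \<in> strip a b1 b2 \<Longrightarrow>
           has_partial_x P (P x t ** q0 p v x t + A ** P x t ** q1) x t"
    and P_t: "\<And>x t. (x, t) \<in> strip a b1 b2 \<Longrightarrow>
           has_partial_t P (matrix_inv A ** P x t ** Qm1 p v \<rho> x t) x t"
    and S_x: "\<And>x t. (x, t) \<in> strip a b1 b2 \<Longrightarrow>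
           has_partial_x S
             (\<i> *\<^sub>C (P x t ** q1 ** mat_pow jmat p ** ctranspose (P (- x) t))) x t"
    and S_t: "\<And>x t. (x, t) \<in> strip a b1 b2 \<Longrightarrow>
           has_partial_t S
             (\<i> *\<^sub>C (matrix_inv A ** P x t ** Qm1 p v \<rho> x t ** mat_pow jmat p
                  ** ctranspose (P (- x) t) ** matrix_inv (ctranspose A))) x t"
begin

abbreviation D :: "(real \<times> real) set" where
  "D \<equiv> strip a b1 b2"

abbreviation J :: "complex^2^2" where
  "J \<equiv> mat_pow jmat p"

abbreviation B :: "complex^'n^'n" where
  "B \<equiv> matrix_inv A"

abbreviation Q :: "real \<Rightarrow> real \<Rightarrow> complex^2^2" where
  "Q \<equiv> Qm1 p v \<rho>"

text \<open>The partner of \<open>P\<close> in the binary Darboux transformation. A local reduction would use \<open>P(x, t)\<close>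
in place of \<open>P(- x, t)\<close>.\<close>

definition L :: "real \<Rightarrow> real \<Rightarrow> complex^'n^2" where
  "L x t = J ** ctranspose (P (- x) t)"

lemma v_has_t:
  assumes "(x, t) \<in> D"
  shows "((\<lambda>s. v x s) has_vector_derivative partial_t v x t) (at t)"
  using v_t[OF assms] by (simp add: partial_t_def vector_derivative_works)

lemma partial_t_Vmat:
  assumes "(x, t) \<in> D"
  shows "partial_t (Vmat v) x t = Vmat (partial_t v) x t"
proof -
  have "((\<lambda>s. Vmat v x s) has_vector_derivative Vmat (partial_t v) x t) (at t)"
  proof (rule has_vector_derivative_matrixI)
    show "((\<lambda>s. Vmat v x s $ i $ k) has_vector_derivative Vmat (partial_t v) x t $ i $ k) (at t)" for i k
      using exhaust_2[of i] exhaust_2[of k] v_has_t[OF assms] v_has_t[OF strip_reflect[OF assms]]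
      by (auto simp: Vmat_def intro!: has_vector_derivative_cnj)
  qed
  then show ?thesis
    by (simp add: partial_t_def vector_derivative_at)
qed

lemma Q_nth:
  assumes "(x, t) \<in> D"
  shows "Q x t $ 1 $ 1 = \<i> * \<rho> x t" "Q x t $ 1 $ 2 = - partial_t v x t"
    "Q x t $ 2 $ 1 = - ((- 1) ^ p * cnj (partial_t v (- x) t))" "Q x t $ 2 $ 2 = - \<i> * \<rho> x t"
  by (simp_all add: Qm1_def partial_t_Vmat[OF assms] Vmat_def matrix_mult_2_nth
      mat_pow_jmat_nth jmat_nth)

text \<open>The reflection symmetries of the coefficients. For \<open>Q\<close> the diagonal needs
\<open>cnj (\<rho> x t) = - \<rho> (- x) t\<close>; the off-diagonal entries are symmetric by construction.\<close>

lemma J_ctranspose_Q: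
  assumes "(x, t) \<in> D"
  shows "J ** ctranspose (Q (- x) t) = Q x t ** J"
  using \<rho>_reflect[OF assms] \<rho>_reflect[OF strip_reflect[OF assms]]
  by (intro matrix_2_eqI) (simp_all add: matrix_mult_2_nth mat_pow_jmat_nth Q_nth assms
      strip_reflect algebra_simps)

lemma J_ctranspose_q0: "J ** ctranspose (q0 p v (- x) t) = q0 p v x t ** J"
  by (rule matrix_2_eqI) (simp_all add: matrix_mult_2_nth mat_pow_jmat_nth q0_nth)

lemma J_ctranspose_q1: "J ** ctranspose q1 = - (q1 ** J)"
  by (rule matrix_2_eqI) (simp_all add: matrix_mult_2_nth mat_pow_jmat_nth q1_nth)

text \<open>The seed equations in Lax form. The lower left entry of \<open>Q\<close> involves the conjugate of \<open>v\<^sub>t\<close> at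
the reflected point, so the equation for \<open>v\<^sub>t\<^sub>x\<close> is used there as well.\<close>

lemma Q_x:
  assumes "(x, t) \<in> D"
  shows "((\<lambda>y. Q y t) has_vector_derivative (Q x t ** q0 p v x t - q0 p v x t ** Q x t)) (at x)"
proof -
  note m = strip_reflect[OF assms]
  note d\<rho> = \<rho>_x[OF assms, unfolded has_partial_x_def]
  note dv = v_tx[OF assms, unfolded has_partial_x_def]
  note dv' = has_vector_derivative_cnj[OF has_vector_derivative_reflect[OF
        v_tx[OF m, unfolded has_partial_x_def]]]
  define q11 q21 where "q11 = (\<lambda>y. \<i> * \<rho> y t)"
    and "q21 = (\<lambda>y. - ((- 1) ^ p * cnj (partial_t v (- y) t)))"
  let ?Q = "\<lambda>y. vector [vector [q11 y, - partial_t v y t], vector [q21 y, - q11 y]] :: complex^2^2"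
  let ?R = "Q x t ** q0 p v x t - q0 p v x t ** Q x t"
  have d11: "(q11 has_vector_derivative ?R $ 1 $ 1) (at x)"
    unfolding q11_def
    by (rule has_vector_derivative_eq_rhs[OF has_vector_derivative_mult_right[OF d\<rho>]])
      (simp add: matrix_mult_2_nth Q_nth[OF assms] q0_nth field_simps)
  have d12: "((\<lambda>y. - partial_t v y t) has_vector_derivative ?R $ 1 $ 2) (at x)"
    by (rule has_vector_derivative_eq_rhs[OF has_vector_derivative_minus[OF dv]])
      (simp add: matrix_mult_2_nth Q_nth[OF assms] q0_nth field_simps)
  have d21: "(q21 has_vector_derivative ?R $ 2 $ 1) (at x)"
    unfolding q21_def
    by (rule has_vector_derivative_eq_rhs[OF
          has_vector_derivative_minus[OF has_vector_derivative_mult_right[OF dv']]])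
      (simp add: matrix_mult_2_nth Q_nth[OF assms] q0_nth \<rho>_reflect[OF m] field_simps)
  have d22: "((\<lambda>y. - q11 y) has_vector_derivative ?R $ 2 $ 2) (at x)"
    by (rule has_vector_derivative_eq_rhs[OF has_vector_derivative_minus[OF d11]])
      (simp add: matrix_mult_2_nth Q_nth[OF assms] q0_nth field_simps)
  have "(?Q has_vector_derivative ?R) (at x)"
  proof (rule has_vector_derivative_matrixI)
    show "((\<lambda>y. ?Q y $ i $ k) has_vector_derivative ?R $ i $ k) (at x)" for i k
      using exhaust_2[of i] exhaust_2[of k] d11 d12 d21 d22 by (elim disjE) simp_all
  qed
  then show ?thesis
    by (rule has_vector_derivative_transform_within_open[OF _ open_strip_section[of t a b1 b2]])
      (auto simp: assms Q_nth q11_def q21_def intro!: matrix_2_eqI)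
qed

abbreviation C :: "complex^'n^'n" where
  "C \<equiv> ctranspose A"

abbreviation E :: "complex^'n^'n" where
  "E \<equiv> ctranspose (matrix_inv A)"

text \<open>Reflection changes the sign of the \<open>x\<close>-derivative, and the symmetry of \<open>q\<^sub>1\<close> contributes a second
sign: this makes \<open>q\<^sub>0\<close>, but not \<open>q\<^sub>1\<close>, appear with a minus sign. In \<open>L_t\<close> no sign changes.\<close>

lemma L_x:
  assumes "(x, t) \<in> D"
  shows "((\<lambda>y. L y t) has_vector_derivative (q1 ** L x t ** C - q0 p v x t ** L x t)) (at x)"
proof -
  note P' = P_x[OF strip_reflect[OF assms], unfolded has_partial_x_def]
  have "J ** (ctranspose (q0 p v (- x) t) ** M) = q0 p v x t ** (J ** M)"
    "J ** (ctranspose q1 ** M) = - (q1 ** (J ** M))" for M :: "complex^'n^2"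
    by (simp_all add: matrix_mul_assoc J_ctranspose_q0 J_ctranspose_q1 matrix_distrib)
  then show ?thesis
    unfolding L_def
    by (intro has_vector_derivative_eq_rhs[OF has_vector_derivative_matrix_mult[OF
            has_vector_derivative_const has_vector_derivative_ctranspose[OF
              has_vector_derivative_reflect[OF P']]]])
      (simp add: matrix_normalize ctranspose_mult ctranspose_arith)
qed

lemma L_t:
  assumes "(x, t) \<in> D"
  shows "((\<lambda>s. L x s) has_vector_derivative (Q x t ** L x t ** E)) (at t)"
proof -
  note P' = P_t[OF strip_reflect[OF assms], unfolded has_partial_t_def]
  have "J ** (ctranspose (Q (- x) t) ** M) = Q x t ** (J ** M)" for M :: "complex^'n^2"
    by (simp add: matrix_mul_assoc J_ctranspose_Q assms)
  then show ?thesis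
    unfolding L_def
    by (intro has_vector_derivative_eq_rhs[OF has_vector_derivative_matrix_mult[OF
            has_vector_derivative_const has_vector_derivative_ctranspose[OF P']]])
      (simp add: matrix_normalize ctranspose_mult)
qed

lemma S_x_L:
  assumes "(x, t) \<in> D"
  shows "((\<lambda>y. S y t) has_vector_derivative \<i> *\<^sub>C (P x t ** q1 ** L x t)) (at x)"
  using S_x[OF assms] by (simp add: has_partial_x_def L_def matrix_mul_assoc)

lemma S_t_L:
  assumes "(x, t) \<in> D"
  shows "((\<lambda>s. S x s) has_vector_derivative \<i> *\<^sub>C (B ** P x t ** Q x t ** L x t ** E)) (at t)"
  using S_t[OF assms]
  by (simp add: has_partial_t_def L_def matrix_mul_assoc matrix_inv_ctranspose[OF inv_A])

lemma A_inverse: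
  "A ** (B ** M) = M" "B ** (A ** M) = M"
  "A ** B = mat 1" "B ** A = mat 1" "C ** E = mat 1" "E ** C = mat 1"
proof -
  show 1: "A ** B = mat 1" "B ** A = mat 1"
    by (simp_all add: matrix_inv_mult inv_A)
  then show "C ** E = mat 1" "E ** C = mat 1"
    by (simp_all add: ctranspose_mult[symmetric] ctranspose_arith)
  show "A ** (B ** M) = M" "B ** (A ** M) = M"
    by (simp_all add: matrix_mul_assoc 1)
qed

text \<open>Both partial derivatives of \<open>S(x, t) + S(- x, t)\<^sup>*\<close> vanish by the symmetries of \<open>q\<^sub>1\<close> and \<open>Q\<close>.\<close>

lemma S_reflect:
  assumes "(x, t) \<in> D"
  shows "S (- x) t = - ctranspose (S x t)"
proof -
  let ?F = "\<lambda>x t. S x t + ctranspose (S (- x) t)"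
  have "?F x t = ?F 0 0"
  proof (rule strip_constant[OF _ _ a b1 b2 assms])
    fix x t assume xt: "(x, t) \<in> D"
    note m = strip_reflect[OF xt]
    have "J ** (ctranspose q1 ** M) = - (q1 ** (J ** M))" for M :: "complex^'n^2"
      by (simp add: matrix_mul_assoc J_ctranspose_q1 matrix_distrib)
    then show "((\<lambda>y. ?F y t) has_vector_derivative 0) (at x)"
      by (intro has_vector_derivative_eq_rhs[OF has_vector_derivative_add[OF S_x_L[OF xt]
              has_vector_derivative_ctranspose[OF has_vector_derivative_reflect[OF S_x_L[OF m]]]]])
        (simp add: matrix_normalize ctranspose_mult ctranspose_arith ctranspose_cmul L_def
          ctranspose_mat_pow_jmat)
    have "J ** (ctranspose (Q (- x) t) ** M) = Q x t ** (J ** M)" for M :: "complex^'n^2"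
      by (simp add: matrix_mul_assoc J_ctranspose_Q xt)
    then show "((\<lambda>s. ?F x s) has_vector_derivative 0) (at t)"
      by (intro has_vector_derivative_eq_rhs[OF has_vector_derivative_add[OF S_t_L[OF xt]
              has_vector_derivative_ctranspose[OF S_t_L[OF m]]]])
        (simp add: matrix_normalize ctranspose_mult ctranspose_arith ctranspose_cmul L_def
          ctranspose_mat_pow_jmat)
  qed
  also have "\<dots> = 0"
    using S0_skew by (simp add: eq_neg_iff_add_eq_0)
  finally have "ctranspose (S x t + ctranspose (S (- x) t)) = ctranspose 0"
    by simp
  then have "ctranspose (S x t) + S (- x) t = 0"
    by (simp only: ctranspose_arith) (simp add: vec_eq_iff)
  then show ?thesis
    by (simp add: eq_neg_iff_add_eq_0 add.commute)
qed

text \<open>The derivatives of the two sides agree: in \<open>(P L)\<^sub>x\<close> the terms with \<open>q\<^sub>0\<close> cancel, and in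
\<open>(P L)\<^sub>t\<close> the terms are those of \<open>A S\<^sub>t + S\<^sub>t A\<^sup>*\<close> after the cancellation of \<open>A\<close> and \<open>A\<^sup>*\<close>.\<close>

lemma sylvester:
  assumes "(x, t) \<in> D"
  shows "A ** S x t + S x t ** C = \<i> *\<^sub>C (P x t ** L x t)"
proof -
  let ?F = "\<lambda>x t. A ** S x t + S x t ** C - \<i> *\<^sub>C (P x t ** L x t)"
  have "?F x t = ?F 0 0"
  proof (rule strip_constant[OF _ _ a b1 b2 assms])
    fix x t assume xt: "(x, t) \<in> D"
    show "((\<lambda>y. ?F y t) has_vector_derivative 0) (at x)"
      by (rule has_vector_derivative_eq_rhs,
          (rule has_vector_derivative_diff has_vector_derivative_add has_vector_derivative_const
            has_vector_derivative_cmul has_vector_derivative_matrix_mult S_x_L[OF xt]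
            L_x[OF xt] P_x[OF xt, unfolded has_partial_x_def])+)
        (simp add: matrix_normalize)
    show "((\<lambda>s. ?F x s) has_vector_derivative 0) (at t)"
      by (rule has_vector_derivative_eq_rhs,
          (rule has_vector_derivative_diff has_vector_derivative_add has_vector_derivative_const
            has_vector_derivative_cmul has_vector_derivative_matrix_mult S_t_L[OF xt]
            L_t[OF xt] P_t[OF xt, unfolded has_partial_t_def])+)
        (simp add: matrix_normalize A_inverse)
  qed
  also have "\<dots> = 0"
    using S0_sylvester by (simp add: L_def matrix_mul_assoc)
  finally show ?thesis
    by simp
qed

section \<open>The transformed Lax equation\<close>

abbreviation T :: "real \<Rightarrow> real \<Rightarrow> complex^'n^'n" where
  "T x t \<equiv> matrix_inv (S x t)"

definition Z :: "real \<Rightarrow> real \<Rightarrow> complex^2^2" where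
  "Z x t = L x t ** T x t ** P x t"

abbreviation W :: "real \<Rightarrow> real \<Rightarrow> complex^2^2" where
  "W x t \<equiv> mat 1 - Xm1 p A S P x t"

abbreviation U :: "real \<Rightarrow> real \<Rightarrow> complex^2^2" where
  "U x t \<equiv> mat 1 + Ym1 p A S P x t"

abbreviation Qt :: "real \<Rightarrow> real \<Rightarrow> complex^2^2" where
  "Qt \<equiv> Qm1_tilde p v \<rho> A S P"

text \<open>The transform of \<open>q\<^sub>0\<close> prescribed by the gauge \<open>W\<close>; it turns out to be \<open>q0 p vt\<close>.\<close>

definition q0t :: "real \<Rightarrow> real \<Rightarrow> complex^2^2" where
  "q0t x t = q0 p v x t + \<i> *\<^sub>C (Z x t ** q1 - q1 ** Z x t)"

abbreviation vt :: "real \<Rightarrow> real \<Rightarrow> complex" where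
  "vt \<equiv> v_tilde v S P"

abbreviation \<rho>t :: "real \<Rightarrow> real \<Rightarrow> complex" where
  "\<rho>t \<equiv> rho_tilde p v \<rho> A S P"

lemma Xm1_eq: "Xm1 p A S P x t = \<i> *\<^sub>C (L x t ** T x t ** B ** P x t)"
  by (simp add: Xm1_def L_def)

lemma Ym1_eq: "Ym1 p A S P x t = (- \<i>) *\<^sub>C (L x t ** E ** T x t ** P x t)"
  by (simp add: Ym1_def L_def)

lemma W_inverse:
  assumes "(x, t) \<in> D" and "invertible (S x t)"
  shows "matrix_inv (W x t) = U x t" "invertible (W x t)"
proof -
  have "W x t ** U x t = mat 1"
    unfolding Xm1_eq Ym1_eq
    by (rule darboux_inverse, rule sylvester_inverse(2)[OF sylvester[OF assms(1)]])
      (simp_all add: A_inverse matrix_inv_mult assms)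
  then have "U x t ** W x t = mat 1"
    by (simp add: matrix_left_right_inverse)
  then show "matrix_inv (W x t) = U x t" "invertible (W x t)"
    by (rule matrix_inv_eqI)+
qed

lemma Z_t:
  assumes "(x, t) \<in> D" and "invertible (S x t)"
  shows "((\<lambda>s. Z x s) has_vector_derivative \<i> *\<^sub>C (Qt x t - Q x t)) (at t)"
  unfolding Z_def Qm1_tilde_def Xm1_eq Ym1_eq
  by (rule darboux_t[OF L_t[OF assms(1)] P_t[OF assms(1), unfolded has_partial_t_def]
        S_t_L[OF assms(1)] assms(2)])

text \<open>An \<open>x\<close>-derivative at a point needs the formulas for the transformed quantities on a neighbourhood
of it; where \<open>S\<close> is singular they may fail.\<close>

lemma open_invertible: "open {y. (y, t) \<in> D \<and> invertible (S y t)}"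
proof -
  have "continuous_on {y. (y, t) \<in> D} (\<lambda>y. det (S y t))"
    unfolding continuous_on_def
  proof (intro ballI tendsto_det)
    fix y assume "y \<in> {y. (y, t) \<in> D}"
    then have "isCont (\<lambda>y. S y t) y"
      using S_x_L has_vector_derivative_continuous by blast
    then show "((\<lambda>y. S y t) \<longlongrightarrow> S y t) (at y within {y. (y, t) \<in> D})"
      unfolding isCont_def by (rule Lim_at_imp_Lim_at_within)
  qed
  then have "open ({y. (y, t) \<in> D} \<inter> (\<lambda>y. det (S y t)) -` (- {0}))"
    by (intro continuous_open_preimage open_strip_section open_Compl closed_singleton)
  then show ?thesis
    by (simp add: invertible_det_nz Int_def vimage_def)
qed

lemma Qt_x:
  assumes xt: "(x, t) \<in> D" and inv: "invertible (S x t)"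
  shows "((\<lambda>y. Qt y t) has_vector_derivative (Qt x t ** q0t x t - q0t x t ** Qt x t)) (at x)"
proof -
  have W: "((\<lambda>y. W y t) has_vector_derivative (W x t ** q0 p v x t - q0t x t ** W x t)) (at x)"
    unfolding Xm1_eq q0t_def Z_def
    by (rule darboux_x[OF L_x[OF xt] P_x[OF xt, unfolded has_partial_x_def] S_x_L[OF xt] inv])
      (simp_all add: A_inverse matrix_inv_mult inv
        sylvester_inverse(1)[OF sylvester[OF xt] A_inverse(4) A_inverse(5)])
  have Qx: "((\<lambda>y. W y t ** Q y t ** matrix_inv (W y t)) has_vector_derivative
      (Qt x t ** q0t x t - q0t x t ** Qt x t)) (at x)"
    using lax_conjugation[OF W Q_x[OF xt] W_inverse(2)[OF xt inv]]
    by (simp add: W_inverse(1)[OF xt inv] Qm1_tilde_def)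
  show ?thesis
    by (rule has_vector_derivative_transform_within_open[OF Qx open_invertible[of t]])
      (use xt inv in \<open>auto simp: W_inverse Qm1_tilde_def\<close>)
qed

lemma matrix_inv_S_reflect:
  assumes "(x, t) \<in> D" and "invertible (S x t)"
  shows "T (- x) t = - ctranspose (T x t)" "invertible (S (- x) t)"
  using matrix_inv_ctranspose[OF assms(2)]
  by (simp_all add: S_reflect[OF assms(1)] matrix_inv_uminus)

lemma J_ctranspose_L: "J ** ctranspose (P (- x) t) = L x t" "ctranspose (L (- x) t) = P x t ** J"
  by (simp_all add: L_def ctranspose_mult ctranspose_arith ctranspose_mat_pow_jmat)

lemma J_ctranspose_Z:
  assumes "(x, t) \<in> D" and "invertible (S x t)"
  shows "J ** ctranspose (Z (- x) t) = - (Z x t ** J)"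
proof -
  have "J ** ctranspose (Z (- x) t)
      = (J ** ctranspose (P (- x) t)) ** ctranspose (T (- x) t) ** ctranspose (L (- x) t)"
    by (simp only: Z_def ctranspose_mult matrix_mul_assoc)
  also have "\<dots> = - (L x t ** T x t ** P x t ** J)"
    unfolding J_ctranspose_L matrix_inv_S_reflect(1)[OF assms]
    by (simp add: ctranspose_arith matrix_normalize)
  finally show ?thesis
    by (simp add: Z_def)
qed

text \<open>Reflection exchanges \<open>X\<close> and \<open>Y\<close> up to sign, hence \<open>W\<close> and its inverse. This makes the reflection
symmetry of \<open>Q\<close> pass to its conjugate by \<open>W\<close>.\<close>

lemma J_ctranspose_X:
  assumes "(x, t) \<in> D" and "invertible (S x t)"
  shows "J ** ctranspose (Xm1 p A S P (- x) t) = - (Ym1 p A S P x t ** J)"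
proof -
  have "J ** ctranspose (Xm1 p A S P (- x) t)
      = (- \<i>) *\<^sub>C ((J ** ctranspose (P (- x) t)) ** E ** ctranspose (T (- x) t) ** ctranspose (L (- x) t))"
    by (simp add: Xm1_eq ctranspose_mult ctranspose_cmul matrix_normalize)
  also have "\<dots> = - ((- \<i>) *\<^sub>C (L x t ** E ** T x t ** P x t) ** J)"
    unfolding J_ctranspose_L matrix_inv_S_reflect(1)[OF assms]
    by (simp add: ctranspose_arith matrix_normalize)
  finally show ?thesis
    by (simp add: Ym1_eq)
qed

lemma J_ctranspose_Y:
  assumes "(x, t) \<in> D" and "invertible (S x t)"
  shows "J ** ctranspose (Ym1 p A S P (- x) t) = - (Xm1 p A S P x t ** J)"
proof -
  have "J ** ctranspose (Ym1 p A S P (- x) t)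
      = \<i> *\<^sub>C ((J ** ctranspose (P (- x) t)) ** ctranspose (T (- x) t) ** B ** ctranspose (L (- x) t))"
    by (simp add: Ym1_eq ctranspose_mult ctranspose_cmul ctranspose_arith matrix_normalize)
  also have "\<dots> = - (\<i> *\<^sub>C (L x t ** T x t ** B ** P x t) ** J)"
    unfolding J_ctranspose_L matrix_inv_S_reflect(1)[OF assms]
    by (simp add: ctranspose_arith matrix_normalize)
  finally show ?thesis
    by (simp add: Xm1_eq)
qed

lemma J_ctranspose_Qt:
  assumes "(x, t) \<in> D" and "invertible (S x t)"
  shows "J ** ctranspose (Qt (- x) t) = Qt x t ** J"
proof -
  have W: "J ** ctranspose (W (- x) t) = U x t ** J"
    and U: "J ** ctranspose (U (- x) t) = W x t ** J"
    by (simp_all add: ctranspose_arith matrix_distrib J_ctranspose_X J_ctranspose_Y assms)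
  have "J ** ctranspose (Qt (- x) t)
      = (J ** ctranspose (U (- x) t)) ** ctranspose (Q (- x) t) ** ctranspose (W (- x) t)"
    by (simp only: Qm1_tilde_def ctranspose_mult matrix_mul_assoc)
  also have "\<dots> = W x t ** (J ** ctranspose (Q (- x) t)) ** ctranspose (W (- x) t)"
    by (simp only: U matrix_mul_assoc)
  also have "\<dots> = W x t ** Q x t ** (J ** ctranspose (W (- x) t))"
    by (simp only: J_ctranspose_Q[OF assms(1)] matrix_mul_assoc)
  also have "\<dots> = Qt x t ** J"
    by (simp only: W Qm1_tilde_def matrix_mul_assoc)
  finally show ?thesis .
qed

lemma Qt_trace:
  assumes "(x, t) \<in> D" and "invertible (S x t)"
  shows "Qt x t $ 1 $ 1 = - Qt x t $ 2 $ 2"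
proof -
  have "trace (Qt x t) = trace (U x t ** (W x t ** Q x t))"
    unfolding Qm1_tilde_def by (rule trace_mul_sym)
  also have "\<dots> = trace (Q x t)"
    using matrix_inv_mult(2)[OF W_inverse(2)[OF assms]]
    by (simp add: W_inverse(1)[OF assms] matrix_mul_assoc)
  also have "\<dots> = 0"
    by (simp add: trace_def sum_2 Q_nth assms)
  finally show ?thesis
    by (simp add: trace_def sum_2 eq_neg_iff_add_eq_0)
qed

lemma \<rho>t_eq: "\<rho>t x t = \<i> * Qt x t $ 2 $ 2"
  by (simp add: rho_tilde_def matrix_matrix_mult_def sum_2 rowvector_def columnvector_def)

lemma vt_eq: "vt x t = v x t + \<i> * Z x t $ 1 $ 2"
proof -
  have "L x t $ 1 $ i = cnj (P (- x) t $ i $ 1)" for i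
    by (simp add: L_def matrix_matrix_mult_def sum_2 mat_pow_jmat_nth)
  then show ?thesis
    by (simp add: v_tilde_def Z_def matrix_matrix_mult_def columnvector_def column_def)
qed

text \<open>The term \<open>v\<^sub>t\<close> cancels against the upper right entry of \<open>Q\<close>.\<close>

lemma vt_t:
  assumes "(x, t) \<in> D" and "invertible (S x t)"
  shows "((\<lambda>s. vt x s) has_vector_derivative - Qt x t $ 1 $ 2) (at t)"
proof -
  have "((\<lambda>s. v x s + \<i> * Z x s $ 1 $ 2) has_vector_derivative
      partial_t v x t + \<i> * (\<i> *\<^sub>C (Qt x t - Q x t)) $ 1 $ 2) (at t)"
    by (intro has_vector_derivative_add v_has_t has_vector_derivative_mult_right
        has_vector_derivative_entry Z_t assms)
  then show ?thesis
    by (simp add: vt_eq Q_nth assms mult.assoc[symmetric])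
qed

lemma partial_t_vt:
  assumes "(x, t) \<in> D" and "invertible (S x t)"
  shows "partial_t vt x t = - Qt x t $ 1 $ 2"
  by (simp add: partial_t_def vector_derivative_at[OF vt_t[OF assms]])

lemma Qt_nth:
  assumes "(x, t) \<in> D" and "invertible (S x t)"
  shows "Qt x t $ 1 $ 1 = \<i> * \<rho>t x t" "Qt x t $ 1 $ 2 = - partial_t vt x t"
    "Qt x t $ 2 $ 1 = - ((- 1) ^ p * cnj (partial_t vt (- x) t))"
    "Qt x t $ 2 $ 2 = - \<i> * \<rho>t x t"
proof -
  note m = strip_reflect[OF assms(1)] matrix_inv_S_reflect(2)[OF assms]
  show "Qt x t $ 1 $ 1 = \<i> * \<rho>t x t" "Qt x t $ 1 $ 2 = - partial_t vt x t"
    "Qt x t $ 2 $ 2 = - \<i> * \<rho>t x t"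
    by (simp_all add: Qt_trace partial_t_vt assms \<rho>t_eq mult.assoc[symmetric])
  show "Qt x t $ 2 $ 1 = - ((- 1) ^ p * cnj (partial_t vt (- x) t))"
    using arg_cong[OF J_ctranspose_Qt[OF assms], where f = "\<lambda>M. M $ 2 $ 1"]
    by (simp add: matrix_mult_2_nth mat_pow_jmat_nth partial_t_vt m)
qed

text \<open>Commuting \<open>Z\<close> with the diagonal matrix \<open>q\<^sub>1\<close> kills the diagonal and rescales the off-diagonal
entries. The lower left one is identified by the reflection symmetry of \<open>Z\<close>.\<close>

lemma q0t_eq:
  assumes "(x, t) \<in> D" and "invertible (S x t)"
  shows "q0t x t = q0 p vt x t"
proof -
  have Z21: "Z x t $ 2 $ 1 = - ((- 1) ^ p * cnj (Z (- x) t $ 1 $ 2))"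
    using arg_cong[OF J_ctranspose_Z[OF assms], where f = "\<lambda>M. M $ 2 $ 1"]
    by (simp add: matrix_mult_2_nth mat_pow_jmat_nth)
  show ?thesis
    by (rule matrix_2_eqI)
      (simp_all add: q0t_def q0_nth matrix_mult_2_nth q1_nth vt_eq Z21 field_simps)
qed

lemma \<rho>t_reflect:
  assumes "(x, t) \<in> D" and "invertible (S x t)"
  shows "cnj (\<rho>t x t) = - \<rho>t (- x) t"
proof -
  have "(- 1) ^ p * cnj (Qt (- x) t $ 2 $ 2) = Qt x t $ 2 $ 2 * (- 1) ^ p"
    using arg_cong[OF J_ctranspose_Qt[OF assms], where f = "\<lambda>M. M $ 2 $ 2"]
    by (simp add: matrix_mult_2_nth mat_pow_jmat_nth)
  then have "cnj (Qt (- x) t $ 2 $ 2) = Qt x t $ 2 $ 2"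
    by simp
  then have "Qt (- x) t $ 2 $ 2 = cnj (Qt x t $ 2 $ 2)"
    by (metis complex_cnj_cnj)
  then show ?thesis
    by (simp add: \<rho>t_eq)
qed

lemma \<rho>t_x:
  assumes "(x, t) \<in> D" and "invertible (S x t)"
  shows "has_partial_x \<rho>t
     ((- 1) ^ p / 2 * (vt x t * cnj (partial_t vt (- x) t)
                       + partial_t vt x t * cnj (vt (- x) t))) x t"
  unfolding has_partial_x_def \<rho>t_eq
  by (rule has_vector_derivative_eq_rhs[OF
        has_vector_derivative_mult_right[OF has_vector_derivative_entry[OF Qt_x[OF assms]]]])
    (simp add: matrix_mult_2_nth q0t_eq[OF assms] q0_nth Qt_nth[OF assms] field_simps)

lemma vt_tx:
  assumes xt: "(x, t) \<in> D" and inv: "invertible (S x t)"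
  shows "has_partial_x (partial_t vt) (\<rho>t x t * vt x t) x t"
proof -
  have "((\<lambda>y. - Qt y t $ 1 $ 2) has_vector_derivative \<rho>t x t * vt x t) (at x)"
    by (rule has_vector_derivative_eq_rhs[OF
          has_vector_derivative_minus[OF has_vector_derivative_entry[OF Qt_x[OF xt inv]]]])
      (simp add: matrix_mult_2_nth q0t_eq[OF xt inv] q0_nth Qt_nth[OF xt inv] field_simps)
  then show ?thesis
    unfolding has_partial_x_def
    by (rule has_vector_derivative_transform_within_open[OF _ open_invertible[of t]])
      (use xt inv in \<open>auto simp: partial_t_vt\<close>)
qed

end

theorem corollary5p2:
  fixes p :: nat
    and a b1 b2 :: ereal
    and v \<rho> :: "real \<Rightarrow> real \<Rightarrow> complex"
    and A :: "complex^'n^'n"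
    and S :: "real \<Rightarrow> real \<Rightarrow> complex^'n^'n"
    and P :: "real \<Rightarrow> real \<Rightarrow> complex^2^'n"
  defines "D \<equiv> strip a b1 b2"
    and "vt \<equiv> v_tilde v S P"
    and "\<rho>t \<equiv> rho_tilde p v \<rho> A S P"
  assumes "p \<in> {0, 1}"
    and "0 < a" and "b1 < 0" and "0 < b2"
    and "\<And>x t. (x, t) \<in> D \<Longrightarrow> (\<lambda>s. v x s) differentiable (at t)"
    and "continuous_on D (\<lambda>(x, t). partial_t v x t)"
    and "\<And>x t. (x, t) \<in> D \<Longrightarrow> cnj (\<rho> x t) = - \<rho> (- x) t"
    and "\<And>x t. (x, t) \<in> D \<Longrightarrow>
           has_partial_x \<rho>
             ((- 1) ^ p / 2 * (v x t * cnj (partial_t v (- x) t)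
                               + partial_t v x t * cnj (v (- x) t))) x t"
    and "\<And>x t. (x, t) \<in> D \<Longrightarrow> has_partial_x (partial_t v) (\<rho> x t * v x t) x t"
    and "invertible A" and "invertible (S 0 0)"
    and "S 0 0 = - ctranspose (S 0 0)"
    and "A ** S 0 0 + S 0 0 ** ctranspose A
           = \<i> *\<^sub>C (P 0 0 ** mat_pow jmat p ** ctranspose (P 0 0))"
    and "\<And>x t. (x, t) \<in> D \<Longrightarrow>
           has_partial_x P (P x t ** q0 p v x t + A ** P x t ** q1) x t"
    and "\<And>x t. (x, t) \<in> D \<Longrightarrow>
           has_partial_t P (matrix_inv A ** P x t ** Qm1 p v \<rho> x t) x t"
    and "\<And>x t. (x, t) \<in> D \<Longrightarrow>
           has_partial_x S
             (\<i> *\<^sub>C (P x t ** q1 ** mat_pow jmat p ** ctranspose (P (- x) t))) x t"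
    and "\<And>x t. (x, t) \<in> D \<Longrightarrow>
           has_partial_t S
             (\<i> *\<^sub>C (matrix_inv A ** P x t ** Qm1 p v \<rho> x t ** mat_pow jmat p
                  ** ctranspose (P (- x) t) ** matrix_inv (ctranspose A))) x t"
  shows "\<forall>(x, t) \<in> D. invertible (S x t) \<longrightarrow>
           invertible (S (- x) t) \<and>
           (\<lambda>s. vt x s) differentiable (at t) \<and>
           (\<lambda>s. vt (- x) s) differentiable (at t) \<and>
           has_partial_x \<rho>t
             ((- 1) ^ p / 2 * (vt x t * cnj (partial_t vt (- x) t)
                               + partial_t vt x t * cnj (vt (- x) t))) x t \<and>
           has_partial_x (partial_t vt) (\<rho>t x t * vt x t) x t \<and>
           cnj (\<rho>t x t) = - \<rho>t (- x) t"
proof -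
  have g: "gbdt p a b1 b2 v \<rho> A S P"
    using assms(5-) unfolding D_def by unfold_locales
  show ?thesis
  proof (clarify, intro conjI)
    fix x t
    assume xt: "(x, t) \<in> D" and inv: "invertible (S x t)"
    note xt = xt[unfolded D_def]
    note inv' = gbdt.matrix_inv_S_reflect(2)[OF g xt inv]
    show "invertible (S (- x) t)" by (rule inv')
    show "(\<lambda>s. vt x s) differentiable (at t)"
      unfolding vt_def by (rule differentiableI_vector[OF gbdt.vt_t[OF g xt inv]])
    show "(\<lambda>s. vt (- x) s) differentiable (at t)"
      unfolding vt_def
      by (rule differentiableI_vector[OF gbdt.vt_t[OF g strip_reflect[OF xt] inv']])
    show "has_partial_x \<rho>t
             ((- 1) ^ p / 2 * (vt x t * cnj (partial_t vt (- x) t)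
                               + partial_t vt x t * cnj (vt (- x) t))) x t"
      unfolding vt_def \<rho>t_def by (rule gbdt.\<rho>t_x[OF g xt inv])
    show "has_partial_x (partial_t vt) (\<rho>t x t * vt x t) x t"
      unfolding vt_def \<rho>t_def by (rule gbdt.vt_tx[OF g xt inv])
    show "cnj (\<rho>t x t) = - \<rho>t (- x) t"
      unfolding \<rho>t_def by (rule gbdt.\<rho>t_reflect[OF g xt inv])
  qed
qed

end
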